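(* Let $(\gamma,\nu_1,\nu_2):I\to\mathbb{R}^3\times\Delta$ be a framed curve with curvature $(\ell,m,n,\alpha)$, let $\theta:I\to\mathbb{R}$ be a smooth function with $\dot\theta(t)=\ell(t)$ for all $t\in I$, let $\{v,w,\mu\}$ be the Bishop frame obtained by rotating $\{\nu_1,\nu_2,\mu\}$ by $\theta$, that is, $v=\cos\theta\,\nu_1-\sin\theta\,\nu_2$ and $w=\sin\theta\,\nu_1+\cos\theta\,\nu_2$, and let $\overline m=m\cos\theta-n\sin\theta$. Suppose that $\overline m(t)\neq0$ for all $t\in I$. If we take $\lambda^{\mathcal E},\eta^{\mathcal E},\theta^{\mathcal E}:I\to\mathbb{R}$ such that $$\lambda^{\mathcal E}=-\frac{\alpha\cos\theta}{\overline m},\qquad \eta^{\mathcal E}=\frac{\alpha\sin\theta}{\overline m},\qquad \theta^{\mathcal E}=\theta,$$ then we have the framed curve $\mathcal{E}(\gamma,\nu_1,\nu_2)=(E_\gamma[v],w,\mu)$; namely, in this case the evolute $\mathcal{E}v(\gamma,\nu_1,\nu_2)$ is the circular evolute $E_\gamma[v]$.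
   Context: All maps are $C^\infty$; $I\subset\mathbb{R}$ is an interval. Let $\Delta=\{(a,b)\in S^2\times S^2\mid a\cdot b=0\}$. A smooth map $(\gamma,\nu_1,\nu_2):I\to\mathbb{R}^3\times\Delta$ is a framed curve if $\dot\gamma\cdot\nu_1=\dot\gamma\cdot\nu_2=0$ on $I$. Put $\mu=\nu_1\times\nu_2$. The curvature $(\ell,m,n,\alpha)$ is $\ell=\dot\nu_1\cdot\nu_2$, $m=\dot\nu_1\cdot\mu$, $n=\dot\nu_2\cdot\mu$, $\alpha=\dot\gamma\cdot\mu$. A Bishop frame is an orthonormal frame $\{v,w,\mu\}$ with $v,w$ in the span of $\nu_1,\nu_2$ and $\dot v,\dot w$ both multiples of $\mu$; the frame $\{v,w,\mu\}$ in the claim is one, and $\dot v=\overline m\mu$. When $\overline m$ is nowhere zero, the (circular) evolute of $\gamma$ with respect to $v$ is $E_\gamma[v](t)=\gamma(t)-\frac{\alpha(t)}{\overline m(t)}v(t)$. Evolute of a framed curve: given a smooth map $(\lambda^{\mathcal E},\eta^{\mathcal E}):I\to\mathbb{R}^2$ and a smooth function $\theta^{\mathcal E}:I\to\mathbb{R}$ satisfying $$\alpha+\lambda^{\mathcal E}m+\eta^{\mathcal E}n=0,\qquad (\dot\lambda^{\mathcal E}-\eta^{\mathcal E}\ell)\sin\theta^{\mathcal E}+(\lambda^{\mathcal E}\ell+\dot\eta^{\mathcal E})\cos\theta^{\mathcal E}=0$$ on $I$, the framed curve $\mathcal{E}(\gamma,\nu_1,\nu_2)=(\mathcal{E}v(\gamma,\nu_1,\nu_2),\nu_1^{\mathcal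 E},\nu_2^{\mathcal E})$ is defined by $\mathcal{E}v(\gamma,\nu_1,\nu_2)=\gamma+\lambda^{\mathcal E}\nu_1+\eta^{\mathcal E}\nu_2$, $\nu_1^{\mathcal E}=\sin\theta^{\mathcal E}\nu_1+\cos\theta^{\mathcal E}\nu_2$, $\nu_2^{\mathcal E}=\mu$, and $\mathcal{E}v(\gamma,\nu_1,\nu_2)$ is called an evolute of $(\gamma,\nu_1,\nu_2)$. The claim includes that the two conditions above are satisfied by the chosen $\lambda^{\mathcal E},\eta^{\mathcal E},\theta^{\mathcal E}$. *)

theory Defs
  imports "HOL-Analysis.Analysis"
begin

(* Derivatives are taken within I, so they are one-sided at an endpoint that belongs to I.
   They are meaningful (unique) only when I has no isolated points. *)
abbreviation deriv_on :: "real set \<Rightarrow> (real \<Rightarrow> 'a::real_normed_vector) \<Rightarrow> real \<Rightarrow> 'a" where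
  "deriv_on I f t \<equiv> vector_derivative f (at t within I)"

definition smooth_on :: "real set \<Rightarrow> (real \<Rightarrow> 'a::real_normed_vector) \<Rightarrow> bool" where
  "smooth_on I f \<longleftrightarrow> (\<forall>k. ((deriv_on I ^^ k) f) differentiable_on I)"

definition nondegenerate_interval :: "real set \<Rightarrow> bool" where
  "nondegenerate_interval I \<longleftrightarrow> is_interval I \<and> interior I \<noteq> {}"

definition Delta :: "((real^3) \<times> (real^3)) set" where
  "Delta = {(a, b). a \<in> sphere 0 1 \<and> b \<in> sphere 0 1 \<and> a \<bullet> b = 0}"

definition framed_curve ::
  "real set \<Rightarrow> (real \<Rightarrow> (real^3) \<times> (real^3) \<times> (real^3)) \<Rightarrow> bool" where
  "framed_curve I F \<longleftrightarrow> smooth_on I F \<and>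
     (\<forall>t\<in>I. let \<gamma> = (\<lambda>s. fst (F s)); \<nu>1 = (\<lambda>s. fst (snd (F s))); \<nu>2 = (\<lambda>s. snd (snd (F s))) in
        (\<nu>1 t, \<nu>2 t) \<in> Delta \<and> deriv_on I \<gamma> t \<bullet> \<nu>1 t = 0 \<and> deriv_on I \<gamma> t \<bullet> \<nu>2 t = 0)"

definition frame_mu :: "(real \<Rightarrow> real^3) \<Rightarrow> (real \<Rightarrow> real^3) \<Rightarrow> real \<Rightarrow> real^3" where
  "frame_mu \<nu>1 \<nu>2 t = cross3 (\<nu>1 t) (\<nu>2 t)"

definition framed_curvature ::
  "real set \<Rightarrow> (real \<Rightarrow> real^3) \<Rightarrow> (real \<Rightarrow> real^3) \<Rightarrow> (real \<Rightarrow> real^3) \<Rightarrow> real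
     \<Rightarrow> real \<times> real \<times> real \<times> real" where
  "framed_curvature I \<gamma> \<nu>1 \<nu>2 t =
     (deriv_on I \<nu>1 t \<bullet> \<nu>2 t,
      deriv_on I \<nu>1 t \<bullet> frame_mu \<nu>1 \<nu>2 t,
      deriv_on I \<nu>2 t \<bullet> frame_mu \<nu>1 \<nu>2 t,
      deriv_on I \<gamma> t \<bullet> frame_mu \<nu>1 \<nu>2 t)"

definition bishop_frame ::
  "real set \<Rightarrow> (real \<Rightarrow> real^3) \<Rightarrow> (real \<Rightarrow> real^3) \<Rightarrow> (real \<Rightarrow> real^3) \<Rightarrow> (real \<Rightarrow> real^3) \<Rightarrow> bool" where
  "bishop_frame I \<nu>1 \<nu>2 v w \<longleftrightarrow> smooth_on I v \<and> smooth_on I w \<and>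
     (\<forall>t\<in>I. let \<mu> = frame_mu \<nu>1 \<nu>2 t in
        norm (v t) = 1 \<and> norm (w t) = 1 \<and> norm \<mu> = 1 \<and>
        v t \<bullet> w t = 0 \<and> v t \<bullet> \<mu> = 0 \<and> w t \<bullet> \<mu> = 0 \<and>
        v t \<in> span {\<nu>1 t, \<nu>2 t} \<and> w t \<in> span {\<nu>1 t, \<nu>2 t} \<and>
        (\<exists>c. deriv_on I v t = c *\<^sub>R \<mu>) \<and> (\<exists>d. deriv_on I w t = d *\<^sub>R \<mu>))"

(* For a Bishop vector v the derivative of v is a multiple of the unit vector mu, so the
   inner product in the denominator is exactly the coefficient of that multiple. *)
definition circular_evolute ::
  "real set \<Rightarrow> (real \<Rightarrow> real^3) \<Rightarrow> (real \<Rightarrow> real^3) \<Rightarrow> (real \<Rightarrow> real^3) \<Rightarrow> (real \<Rightarrow> real^3)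
     \<Rightarrow> real \<Rightarrow> real^3" where
  "circular_evolute I \<gamma> \<nu>1 \<nu>2 v t =
     \<gamma> t - ((deriv_on I \<gamma> t \<bullet> frame_mu \<nu>1 \<nu>2 t) / (deriv_on I v t \<bullet> frame_mu \<nu>1 \<nu>2 t)) *\<^sub>R v t"

definition evolute_data ::
  "real set \<Rightarrow> (real \<Rightarrow> real^3) \<Rightarrow> (real \<Rightarrow> real^3) \<Rightarrow> (real \<Rightarrow> real^3)
     \<Rightarrow> (real \<Rightarrow> real) \<Rightarrow> (real \<Rightarrow> real) \<Rightarrow> (real \<Rightarrow> real) \<Rightarrow> bool" where
  "evolute_data I \<gamma> \<nu>1 \<nu>2 lam eta th \<longleftrightarrow>
     smooth_on I (\<lambda>t. (lam t, eta t)) \<and> smooth_on I th \<and>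
     (\<forall>t\<in>I. case framed_curvature I \<gamma> \<nu>1 \<nu>2 t of (l, m, n, \<alpha>) \<Rightarrow>
        \<alpha> + lam t * m + eta t * n = 0 \<and>
        (deriv_on I lam t - eta t * l) * sin (th t) + (lam t * l + deriv_on I eta t) * cos (th t) = 0)"

definition evolute_curve ::
  "(real \<Rightarrow> real^3) \<Rightarrow> (real \<Rightarrow> real^3) \<Rightarrow> (real \<Rightarrow> real^3)
     \<Rightarrow> (real \<Rightarrow> real) \<Rightarrow> (real \<Rightarrow> real) \<Rightarrow> real \<Rightarrow> real^3" where
  "evolute_curve \<gamma> \<nu>1 \<nu>2 lam eta t = \<gamma> t + lam t *\<^sub>R \<nu>1 t + eta t *\<^sub>R \<nu>2 t"

definition framed_evolute ::
  "(real \<Rightarrow> real^3) \<Rightarrow> (real \<Rightarrow> real^3) \<Rightarrow> (real \<Rightarrow> real^3)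
     \<Rightarrow> (real \<Rightarrow> real) \<Rightarrow> (real \<Rightarrow> real) \<Rightarrow> (real \<Rightarrow> real) \<Rightarrow> real
     \<Rightarrow> (real^3) \<times> (real^3) \<times> (real^3)" where
  "framed_evolute \<gamma> \<nu>1 \<nu>2 lam eta th t =
     (evolute_curve \<gamma> \<nu>1 \<nu>2 lam eta t,
      sin (th t) *\<^sub>R \<nu>1 t + cos (th t) *\<^sub>R \<nu>2 t,
      frame_mu \<nu>1 \<nu>2 t)"

end

theory Submission
  imports Defs
begin

text \<open>
  The angle \<open>\<theta>\<close> with \<open>\<theta>' = l\<close> is chosen so that the rotation of the normal plane cancels
  the parts of \<open>\<nu>1'\<close> and \<open>\<nu>2'\<close> that lie in that plane: since \<open>\<nu>1' = l \<nu>2 + m \<mu>\<close> and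
  \<open>\<nu>2' = - l \<nu>1 + n \<mu>\<close>, the rotated vectors satisfy \<open>v' = mbar \<mu>\<close> and
  \<open>w' = (m sin \<theta> + n cos \<theta>) \<mu>\<close>.  Put \<open>r = \<alpha> / mbar\<close>.  Then \<open>lam = - r cos \<theta>\<close> and
  \<open>eta = r sin \<theta>\<close> are the coordinates of \<open>- r v\<close> in the basis \<open>\<nu>1, \<nu>2\<close>, so the evolute
  curve is \<open>\<gamma> - r v\<close>, the circular evolute.  The second condition on the evolute data says
  that the \<open>w\<close>-component of its velocity vanishes, and the first one that the
  \<open>\<mu>\<close>-component does; both hold because
  \<open>(\<gamma> - r v)' = \<alpha> \<mu> - r' v - r mbar \<mu> = - r' v\<close>.
  The same formula shows that \<open>(\<gamma> - r v, w, \<mu>)\<close> is a framed curve.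

  The structure equations are read off from the orthonormal basis \<open>\<nu>1, \<nu>2, \<nu>1 \<times> \<nu>2\<close>
  of three-space (\<open>orthonormal_cross3_expansion\<close>).  What remains is that every map in
  question is smooth.  Smoothness is defined by iterated derivatives within the interval, so its
  closure properties are proved by induction on the order of differentiability, where the
  Leibniz rule for an arbitrary bounded bilinear map covers multiplication, scaling,
  inner product and cross product at once.
\<close>

section \<open>Smooth maps on an interval\<close>

lemma nontrivial_limit_within_nondegenerate_interval:
  assumes "nondegenerate_interval I" "t \<in> I"
  shows "at t within I \<noteq> bot"
proof -
  have "connected I"
    using assms(1) by (simp add: nondegenerate_interval_def is_interval_connected)
  moreover have "I \<noteq> {x}" for x
    using assms(1) by (auto simp: nondegenerate_interval_def)
  ultimately have "t islimpt I"
    using assms(2) by (intro connected_imp_perfect)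
  then show ?thesis
    by (simp add: trivial_limit_within)
qed

lemma deriv_on_cong:
  assumes "t \<in> I" "\<And>s. s \<in> I \<Longrightarrow> f s = g s"
  shows "deriv_on I f t = deriv_on I g t"
  by (rule vector_derivative_cong_eq) (use assms in auto)

lemma iterated_deriv_on_cong:
  assumes "\<And>s. s \<in> I \<Longrightarrow> f s = g s" "t \<in> I"
  shows "(deriv_on I ^^ k) f t = (deriv_on I ^^ k) g t"
  using assms(2)
proof (induction k arbitrary: t)
  case 0
  then show ?case using assms(1) by simp
next
  case (Suc k)
  then show ?case
    by (auto intro: deriv_on_cong)
qed

text \<open>
  Smoothness graded by the order of differentiability.  Order \<open>0\<close> imposes no condition at
  all, so that inductions on the order have a trivial base case.
\<close>

definition times_differentiable_on ::
  "nat \<Rightarrow> real set \<Rightarrow> (real \<Rightarrow> 'a::real_normed_vector) \<Rightarrow> bool" where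
  "times_differentiable_on k I f \<longleftrightarrow> (\<forall>j<k. ((deriv_on I ^^ j) f) differentiable_on I)"

lemma smooth_on_iff_times_differentiable_on:
  "smooth_on I f \<longleftrightarrow> (\<forall>k. times_differentiable_on k I f)"
  by (auto simp: smooth_on_def times_differentiable_on_def)

lemma times_differentiable_on_0 [simp]: "times_differentiable_on 0 I f"
  by (simp add: times_differentiable_on_def)

lemma times_differentiable_on_Suc:
  "times_differentiable_on (Suc k) I f \<longleftrightarrow>
     f differentiable_on I \<and> times_differentiable_on k I (deriv_on I f)"
  unfolding times_differentiable_on_def All_less_Suc2
  by (simp add: funpow_Suc_right del: funpow.simps)

lemma times_differentiable_on_pred:
  "times_differentiable_on (Suc k) I f \<Longrightarrow> times_differentiable_on k I f"
  by (simp add: times_differentiable_on_def)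

lemma times_differentiable_on_cong:
  assumes "\<And>s. s \<in> I \<Longrightarrow> f s = g s"
  shows "times_differentiable_on k I f \<longleftrightarrow> times_differentiable_on k I g"
proof -
  have "h differentiable_on I"
    if "h' differentiable_on I" "\<And>s. s \<in> I \<Longrightarrow> h' s = h s" for h h' :: "real \<Rightarrow> 'a"
    using that differentiable_transform_within[of h' _ I 1 h]
    by (simp add: differentiable_on_def)
  then show ?thesis
    using iterated_deriv_on_cong[of I f g, OF assms] iterated_deriv_on_cong[of I g f, OF assms[symmetric]]
    unfolding times_differentiable_on_def by (intro iffI allI impI) blast+
qed

lemma smooth_on_cong:
  assumes "\<And>s. s \<in> I \<Longrightarrow> f s = g s"
  shows "smooth_on I f \<longleftrightarrow> smooth_on I g"
  using times_differentiable_on_cong[of I f g, OF assms]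
  by (simp add: smooth_on_iff_times_differentiable_on)

lemma smooth_on_deriv_on:
  assumes "smooth_on I f"
  shows "smooth_on I (deriv_on I f)"
proof -
  have "times_differentiable_on (Suc k) I f" for k
    using assms by (simp only: smooth_on_iff_times_differentiable_on)
  then show ?thesis
    by (simp add: smooth_on_iff_times_differentiable_on times_differentiable_on_Suc)
qed

lemma times_differentiable_on_has_vector_derivative:
  assumes "times_differentiable_on (Suc k) I f" "t \<in> I"
  shows "(f has_vector_derivative deriv_on I f t) (at t within I)"
  using assms
  by (simp add: times_differentiable_on_Suc differentiable_on_def
      flip: vector_derivative_works)

lemma smooth_on_has_vector_derivative:
  assumes "smooth_on I f" "t \<in> I"
  shows "(f has_vector_derivative deriv_on I f t) (at t within I)"
  by (rule times_differentiable_on_has_vector_derivative[of 0])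
    (use assms in \<open>simp_all add: smooth_on_iff_times_differentiable_on\<close>)

lemma bounded_bilinear_cross3: "bounded_bilinear cross3"
  using bilinear_cross bilinear_conv_bounded_bilinear by blast

text \<open>
  The assumption says that \<open>I\<close> has no isolated points.  It makes derivatives within \<open>I\<close>
  unique, so that a derivative computed by the usual rules is the value of \<open>deriv_on\<close>.
\<close>

context
  fixes I :: "real set"
  assumes perfect: "\<And>t. t \<in> I \<Longrightarrow> at t within I \<noteq> bot"
begin

lemma deriv_on_eqI:
  "t \<in> I \<Longrightarrow> (f has_vector_derivative d) (at t within I) \<Longrightarrow> deriv_on I f t = d"
  by (rule vector_derivative_within) (rule perfect)

lemma times_differentiable_on_SucI:
  assumes "\<And>t. t \<in> I \<Longrightarrow> (f has_vector_derivative f' t) (at t within I)"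
    and "times_differentiable_on k I f'"
  shows "times_differentiable_on (Suc k) I f"
proof -
  have "f differentiable_on I"
    using assms(1) by (auto simp: differentiable_on_def intro: differentiableI_vector)
  moreover have "times_differentiable_on k I (deriv_on I f)"
    using assms(2) times_differentiable_on_cong[of I "deriv_on I f" f' k]
      deriv_on_eqI[OF _ assms(1)] by simp
  ultimately show ?thesis
    by (simp add: times_differentiable_on_Suc)
qed

lemma times_differentiable_on_bounded_linear:
  assumes "bounded_linear h" "times_differentiable_on k I f"
  shows "times_differentiable_on k I (\<lambda>t. h (f t))"
  using assms(2)
proof (induction k arbitrary: f)
  case (Suc k)
  show ?case
  proof (rule times_differentiable_on_SucI)
    show "((\<lambda>t. h (f t)) has_vector_derivative h (deriv_on I f t)) (at t within I)" if "t \<in> I" for t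
      using bounded_linear.has_vector_derivative[OF assms(1)]
        times_differentiable_on_has_vector_derivative[OF Suc.prems that] .
  qed (use Suc in \<open>simp add: times_differentiable_on_Suc\<close>)
qed simp

lemma times_differentiable_on_add:
  assumes "times_differentiable_on k I f" "times_differentiable_on k I g"
  shows "times_differentiable_on k I (\<lambda>t. f t + g t)"
  using assms
proof (induction k arbitrary: f g)
  case (Suc k)
  show ?case
  proof (rule times_differentiable_on_SucI)
    show "((\<lambda>t. f t + g t) has_vector_derivative deriv_on I f t + deriv_on I g t) (at t within I)"
      if "t \<in> I" for t
      using that Suc.prems
      by (intro has_vector_derivative_add times_differentiable_on_has_vector_derivative)
  qed (use Suc in \<open>simp add: times_differentiable_on_Suc\<close>)
qed simp

lemma times_differentiable_on_bounded_bilinear: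
  assumes "bounded_bilinear b" "times_differentiable_on k I f" "times_differentiable_on k I g"
  shows "times_differentiable_on k I (\<lambda>t. b (f t) (g t))"
  using assms(2,3)
proof (induction k arbitrary: f g)
  case (Suc k)
  show ?case
  proof (rule times_differentiable_on_SucI)
    show "((\<lambda>t. b (f t) (g t)) has_vector_derivative
             b (f t) (deriv_on I g t) + b (deriv_on I f t) (g t)) (at t within I)" if "t \<in> I" for t
      using that Suc.prems
      by (intro bounded_bilinear.has_vector_derivative[OF assms(1)]
          times_differentiable_on_has_vector_derivative)
    show "times_differentiable_on k I (\<lambda>t. b (f t) (deriv_on I g t) + b (deriv_on I f t) (g t))"
      using Suc.prems Suc.prems[THEN times_differentiable_on_pred]
      by (intro times_differentiable_on_add Suc.IH) (auto simp: times_differentiable_on_Suc)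
  qed
qed simp

text \<open>
  Sine and cosine go together, because the derivative of each involves the other.
\<close>

lemma times_differentiable_on_cos_sin:
  fixes f :: "real \<Rightarrow> real"
  assumes "times_differentiable_on k I f"
  shows "times_differentiable_on k I (\<lambda>t. cos (f t)) \<and> times_differentiable_on k I (\<lambda>t. sin (f t))"
  using assms
proof (induction k)
  case (Suc k)
  note IH = Suc.IH[OF times_differentiable_on_pred[OF Suc.prems]]
  have D: "times_differentiable_on k I (deriv_on I f)"
    using Suc.prems by (simp add: times_differentiable_on_Suc)
  have f': "(f has_real_derivative deriv_on I f t) (at t within I)" if "t \<in> I" for t
    using times_differentiable_on_has_vector_derivative[OF Suc.prems that]
    by (simp add: has_real_derivative_iff_has_vector_derivative)
  have "((\<lambda>t. cos (f t)) has_vector_derivative - (sin (f t) * deriv_on I f t)) (at t within I)"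
    "((\<lambda>t. sin (f t)) has_vector_derivative cos (f t) * deriv_on I f t) (at t within I)"
    if "t \<in> I" for t
    unfolding has_real_derivative_iff_has_vector_derivative[symmetric]
    by (auto intro!: derivative_eq_intros f' that)
  moreover have "times_differentiable_on k I (\<lambda>t. - (sin (f t) * deriv_on I f t))"
    using IH D by (intro times_differentiable_on_bounded_linear[OF bounded_linear_minus[OF bounded_linear_ident]]
        times_differentiable_on_bounded_bilinear[OF bounded_bilinear_mult]) auto
  moreover have "times_differentiable_on k I (\<lambda>t. cos (f t) * deriv_on I f t)"
    using IH D by (intro times_differentiable_on_bounded_bilinear[OF bounded_bilinear_mult]) auto
  ultimately show ?case
    by (intro conjI times_differentiable_on_SucI)
qed simp

lemma times_differentiable_on_inverse:
  fixes f :: "real \<Rightarrow> real"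
  assumes "times_differentiable_on k I f" "\<And>t. t \<in> I \<Longrightarrow> f t \<noteq> 0"
  shows "times_differentiable_on k I (\<lambda>t. inverse (f t))"
  using assms(1)
proof (induction k)
  case (Suc k)
  note IH = Suc.IH[OF times_differentiable_on_pred[OF Suc.prems]]
  show ?case
  proof (rule times_differentiable_on_SucI)
    fix t assume t: "t \<in> I"
    have "(f has_real_derivative deriv_on I f t) (at t within I)"
      using times_differentiable_on_has_vector_derivative[OF Suc.prems t]
      by (simp add: has_real_derivative_iff_has_vector_derivative)
    then show "((\<lambda>t. inverse (f t)) has_vector_derivative
        - (inverse (f t) * inverse (f t) * deriv_on I f t)) (at t within I)"
      unfolding has_real_derivative_iff_has_vector_derivative[symmetric]
      by (auto intro!: derivative_eq_intros assms(2) t)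
  next
    show "times_differentiable_on k I (\<lambda>t. - (inverse (f t) * inverse (f t) * deriv_on I f t))"
      using IH Suc.prems
      by (intro times_differentiable_on_bounded_linear[OF bounded_linear_minus[OF bounded_linear_ident]]
          times_differentiable_on_bounded_bilinear[OF bounded_bilinear_mult])
        (auto simp: times_differentiable_on_Suc)
  qed
qed simp

lemma smooth_on_bounded_linear:
  "bounded_linear h \<Longrightarrow> smooth_on I f \<Longrightarrow> smooth_on I (\<lambda>t. h (f t))"
  by (simp add: smooth_on_iff_times_differentiable_on times_differentiable_on_bounded_linear)

lemma smooth_on_bounded_bilinear:
  "bounded_bilinear b \<Longrightarrow> smooth_on I f \<Longrightarrow> smooth_on I g \<Longrightarrow> smooth_on I (\<lambda>t. b (f t) (g t))"
  by (simp add: smooth_on_iff_times_differentiable_on times_differentiable_on_bounded_bilinear)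

lemma smooth_on_add: "smooth_on I f \<Longrightarrow> smooth_on I g \<Longrightarrow> smooth_on I (\<lambda>t. f t + g t)"
  by (simp add: smooth_on_iff_times_differentiable_on times_differentiable_on_add)

lemma smooth_on_minus: "smooth_on I f \<Longrightarrow> smooth_on I (\<lambda>t. - f t)"
  by (rule smooth_on_bounded_linear[OF bounded_linear_minus[OF bounded_linear_ident]])

lemma smooth_on_diff: "smooth_on I f \<Longrightarrow> smooth_on I g \<Longrightarrow> smooth_on I (\<lambda>t. f t - g t)"
  using smooth_on_add[of f "\<lambda>t. - g t"] smooth_on_minus[of g] by simp

lemma smooth_on_cos: "smooth_on I f \<Longrightarrow> smooth_on I (\<lambda>t. cos (f t))"
  and smooth_on_sin: "smooth_on I f \<Longrightarrow> smooth_on I (\<lambda>t. sin (f t))"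
  for f :: "real \<Rightarrow> real"
  by (simp_all add: smooth_on_iff_times_differentiable_on times_differentiable_on_cos_sin)

lemma smooth_on_divide:
  fixes f g :: "real \<Rightarrow> real"
  assumes "smooth_on I f" "smooth_on I g" "\<And>t. t \<in> I \<Longrightarrow> g t \<noteq> 0"
  shows "smooth_on I (\<lambda>t. f t / g t)"
  unfolding divide_inverse using assms
  by (intro smooth_on_bounded_bilinear[OF bounded_bilinear_mult])
    (simp_all add: smooth_on_iff_times_differentiable_on times_differentiable_on_inverse)

lemma smooth_on_Pair:
  assumes "smooth_on I f" "smooth_on I g"
  shows "smooth_on I (\<lambda>t. (f t, g t))"
proof -
  have "smooth_on I (\<lambda>t. (f t, 0) + (0, g t))"
    using assms
    by (intro smooth_on_add smooth_on_bounded_linear[of "\<lambda>x. (x, 0)"]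
        smooth_on_bounded_linear[of "\<lambda>x. (0, x)"] bounded_linear_Pair
        bounded_linear_ident bounded_linear_zero)
  then show ?thesis by simp
qed

lemmas smooth_on_intros =
  smooth_on_add smooth_on_diff smooth_on_minus smooth_on_cos smooth_on_sin
  smooth_on_divide smooth_on_Pair smooth_on_deriv_on
  smooth_on_bounded_bilinear[OF bounded_bilinear_mult]
  smooth_on_bounded_bilinear[OF bounded_bilinear_scaleR]
  smooth_on_bounded_bilinear[OF bounded_bilinear_inner]
  smooth_on_bounded_bilinear[OF bounded_bilinear_cross3]

lemma inner_deriv_on_eq_0_if_inner_const:
  assumes "smooth_on I f" "smooth_on I g" "\<And>t. t \<in> I \<Longrightarrow> f t \<bullet> g t = c" "t \<in> I"
  shows "f t \<bullet> deriv_on I g t + deriv_on I f t \<bullet> g t = 0"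
proof -
  have "((\<lambda>t. f t \<bullet> g t) has_vector_derivative f t \<bullet> deriv_on I g t + deriv_on I f t \<bullet> g t)
          (at t within I)"
    using assms by (intro bounded_bilinear.has_vector_derivative[OF bounded_bilinear_inner]
        smooth_on_has_vector_derivative)
  moreover have "((\<lambda>t. f t \<bullet> g t) has_vector_derivative 0) (at t within I)"
    by (rule has_vector_derivative_transform[OF \<open>t \<in> I\<close> assms(3) has_vector_derivative_const])
  ultimately show ?thesis
    using deriv_on_eqI[OF \<open>t \<in> I\<close>] by metis
qed

end

section \<open>Framed curves\<close>

text \<open>
  A vector orthogonal to \<open>a\<close>, \<open>b\<close> and \<open>a \<times> b\<close> has vanishing inner and cross product with
  \<open>a \<times> b\<close> and is therefore zero; applied to the difference of the two sides this gives the
  expansion.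
\<close>

lemma orthonormal_cross3_expansion:
  fixes a b x :: "real^3"
  assumes "norm a = 1" "norm b = 1" "a \<bullet> b = 0"
  shows "x = (x \<bullet> a) *\<^sub>R a + (x \<bullet> b) *\<^sub>R b + (x \<bullet> cross3 a b) *\<^sub>R cross3 a b"
proof -
  let ?c = "cross3 a b"
  have aa: "a \<bullet> a = 1" "b \<bullet> b = 1"
    using assms by (simp_all add: norm_eq_1)
  have cc: "?c \<bullet> ?c = 1"
    using norm_cross[of a b] assms by (simp add: power2_norm_eq_inner)
  define y where "y = x - ((x \<bullet> a) *\<^sub>R a + (x \<bullet> b) *\<^sub>R b + (x \<bullet> ?c) *\<^sub>R ?c)"
  have orth: "a \<bullet> ?c = 0" "b \<bullet> ?c = 0" "?c \<bullet> a = 0" "?c \<bullet> b = 0" "b \<bullet> a = 0"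
    using dot_cross_self[of a b] dot_cross_self[of b a] assms(3) by (simp_all add: inner_commute)
  have y: "y \<bullet> a = 0" "y \<bullet> b = 0" "y \<bullet> ?c = 0"
    using aa cc orth assms(3) by (simp_all add: y_def inner_diff_left inner_add_left)
  have "cross3 y ?c = (y \<bullet> b) *\<^sub>R a - (y \<bullet> a) *\<^sub>R b"
    by (simp add: cross3_simps forall_3)
  then have "cross3 y ?c = 0"
    using y by simp
  then have "y = 0 \<or> ?c = 0"
    using y norm_and_cross_eq_0 by blast
  then show ?thesis
    using cc by (auto simp: y_def)
qed

lemma framed_curve_cong:
  assumes "\<And>t. t \<in> I \<Longrightarrow> F t = G t"
  shows "framed_curve I F \<longleftrightarrow> framed_curve I G"
proof -
  have "deriv_on I (\<lambda>s. fst (F s)) t = deriv_on I (\<lambda>s. fst (G s)) t" if "t \<in> I" for t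
    using that assms by (intro deriv_on_cong) auto
  then show ?thesis
    using assms by (auto simp: framed_curve_def smooth_on_cong[of I F G, OF assms] Let_def)
qed

text \<open>
  Differentiating the orthonormality relations of \<open>\<nu>1\<close> and \<open>\<nu>2\<close> leaves only the coordinates
  in the moving frame that the curvature records.
\<close>

lemma framed_curve_structure_equations:
  assumes I: "nondegenerate_interval I" and t: "t \<in> I"
    and F: "framed_curve I (\<lambda>t. (\<gamma> t, \<nu>1 t, \<nu>2 t))"
    and curv: "framed_curvature I \<gamma> \<nu>1 \<nu>2 t = (l, m, n, \<alpha>)"
  shows "deriv_on I \<gamma> t = \<alpha> *\<^sub>R frame_mu \<nu>1 \<nu>2 t"
    and "deriv_on I \<nu>1 t = l *\<^sub>R \<nu>2 t + m *\<^sub>R frame_mu \<nu>1 \<nu>2 t"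
    and "deriv_on I \<nu>2 t = - l *\<^sub>R \<nu>1 t + n *\<^sub>R frame_mu \<nu>1 \<nu>2 t"
proof -
  note perfect = nontrivial_limit_within_nondegenerate_interval[OF I]
  have sm: "smooth_on I (\<lambda>t. (\<gamma> t, \<nu>1 t, \<nu>2 t))"
    using F by (simp add: framed_curve_def)
  have s1: "smooth_on I \<nu>1"
    using smooth_on_bounded_linear[OF perfect _ sm, of "\<lambda>x. fst (snd x)"]
    by (simp add: bounded_linear_intros)
  have s2: "smooth_on I \<nu>2"
    using smooth_on_bounded_linear[OF perfect _ sm, of "\<lambda>x. snd (snd x)"]
    by (simp add: bounded_linear_intros)
  have on: "norm (\<nu>1 s) = 1" "norm (\<nu>2 s) = 1" "\<nu>1 s \<bullet> \<nu>2 s = 0"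
    "deriv_on I \<gamma> s \<bullet> \<nu>1 s = 0" "deriv_on I \<gamma> s \<bullet> \<nu>2 s = 0" if "s \<in> I" for s
    using F that by (auto simp: framed_curve_def Delta_def Let_def)
  have "\<nu>1 t \<bullet> deriv_on I \<nu>1 t + deriv_on I \<nu>1 t \<bullet> \<nu>1 t = 0"
    by (rule inner_deriv_on_eq_0_if_inner_const[OF perfect s1 s1 _ t, of 1])
      (use on in \<open>auto simp: norm_eq_1\<close>)
  then have 11: "deriv_on I \<nu>1 t \<bullet> \<nu>1 t = 0"
    by (simp add: inner_commute)
  have "\<nu>2 t \<bullet> deriv_on I \<nu>2 t + deriv_on I \<nu>2 t \<bullet> \<nu>2 t = 0"
    by (rule inner_deriv_on_eq_0_if_inner_const[OF perfect s2 s2 _ t, of 1])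
      (use on in \<open>auto simp: norm_eq_1\<close>)
  then have 22: "deriv_on I \<nu>2 t \<bullet> \<nu>2 t = 0"
    by (simp add: inner_commute)
  have "\<nu>1 t \<bullet> deriv_on I \<nu>2 t + deriv_on I \<nu>1 t \<bullet> \<nu>2 t = 0"
    by (rule inner_deriv_on_eq_0_if_inner_const[OF perfect s1 s2 _ t, of 0]) (use on in auto)
  then have 21: "deriv_on I \<nu>2 t \<bullet> \<nu>1 t = - l"
    using curv by (simp add: framed_curvature_def inner_commute)
  note exp = orthonormal_cross3_expansion[OF on(1-3)[OF t], folded frame_mu_def]
  show "deriv_on I \<gamma> t = \<alpha> *\<^sub>R frame_mu \<nu>1 \<nu>2 t"
    using exp[of "deriv_on I \<gamma> t"] on(4,5)[OF t] curv by (simp add: framed_curvature_def)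
  show "deriv_on I \<nu>1 t = l *\<^sub>R \<nu>2 t + m *\<^sub>R frame_mu \<nu>1 \<nu>2 t"
    using exp[of "deriv_on I \<nu>1 t"] 11 curv by (simp add: framed_curvature_def)
  show "deriv_on I \<nu>2 t = - l *\<^sub>R \<nu>1 t + n *\<^sub>R frame_mu \<nu>1 \<nu>2 t"
    using exp[of "deriv_on I \<nu>2 t"] 21 22 curv by (simp add: framed_curvature_def)
qed

section \<open>The circular evolute as an evolute\<close>

theorem proposition6p4:
  fixes I :: "real set"
    and \<gamma> \<nu>1 \<nu>2 v w :: "real \<Rightarrow> real^3"
    and l m n \<alpha> \<theta> mbar lam eta th :: "real \<Rightarrow> real"
  assumes "nondegenerate_interval I"
    and "framed_curve I (\<lambda>t. (\<gamma> t, \<nu>1 t, \<nu>2 t))"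
    and "\<forall>t\<in>I. framed_curvature I \<gamma> \<nu>1 \<nu>2 t = (l t, m t, n t, \<alpha> t)"
    and "smooth_on I \<theta>"
    and "\<forall>t\<in>I. deriv_on I \<theta> t = l t"
    and "\<forall>t\<in>I. v t = cos (\<theta> t) *\<^sub>R \<nu>1 t - sin (\<theta> t) *\<^sub>R \<nu>2 t"
    and "\<forall>t\<in>I. w t = sin (\<theta> t) *\<^sub>R \<nu>1 t + cos (\<theta> t) *\<^sub>R \<nu>2 t"
    and "\<forall>t\<in>I. mbar t = m t * cos (\<theta> t) - n t * sin (\<theta> t)"
    and "\<forall>t\<in>I. mbar t \<noteq> 0"
    and "\<forall>t\<in>I. lam t = - (\<alpha> t * cos (\<theta> t)) / mbar t"
    and "\<forall>t\<in>I. eta t = \<alpha> t * sin (\<theta> t) / mbar t"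
    and "\<forall>t\<in>I. th t = \<theta> t"
  shows "bishop_frame I \<nu>1 \<nu>2 v w \<and>
         (\<forall>t\<in>I. deriv_on I v t = mbar t *\<^sub>R frame_mu \<nu>1 \<nu>2 t) \<and>
         evolute_data I \<gamma> \<nu>1 \<nu>2 lam eta th \<and>
         framed_curve I (framed_evolute \<gamma> \<nu>1 \<nu>2 lam eta th) \<and>
         (\<forall>t\<in>I. framed_evolute \<gamma> \<nu>1 \<nu>2 lam eta th t =
                  (circular_evolute I \<gamma> \<nu>1 \<nu>2 v t, w t, frame_mu \<nu>1 \<nu>2 t)) \<and>
         (\<forall>t\<in>I. evolute_curve \<gamma> \<nu>1 \<nu>2 lam eta t = circular_evolute I \<gamma> \<nu>1 \<nu>2 v t)"
proof (intro conjI)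
  let ?\<mu> = "frame_mu \<nu>1 \<nu>2"
  define r where "r t = \<alpha> t / mbar t" for t
  note I = assms(1) and F = assms(2) and curv = assms(3)[rule_format]
    and v = assms(6)[rule_format] and w = assms(7)[rule_format]
    and mbar = assms(8)[rule_format] and mbar0 = assms(9)[rule_format]
  note perfect = nontrivial_limit_within_nondegenerate_interval[OF I]
  note smooth_intros = smooth_on_intros[OF perfect]
  have lam: "lam t = - (r t * cos (\<theta> t))" and eta: "eta t = r t * sin (\<theta> t)" if "t \<in> I" for t
    using that assms(10,11) by (auto simp: r_def)

  have sF: "smooth_on I (\<lambda>t. (\<gamma> t, \<nu>1 t, \<nu>2 t))"
    using F by (simp add: framed_curve_def)
  have s0: "smooth_on I \<gamma>"
    using smooth_on_bounded_linear[OF perfect _ sF, of fst] by (simp add: bounded_linear_intros)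
  have s1: "smooth_on I \<nu>1"
    using smooth_on_bounded_linear[OF perfect _ sF, of "\<lambda>x. fst (snd x)"]
    by (simp add: bounded_linear_intros)
  have s2: "smooth_on I \<nu>2"
    using smooth_on_bounded_linear[OF perfect _ sF, of "\<lambda>x. snd (snd x)"]
    by (simp add: bounded_linear_intros)
  have s\<mu>: "smooth_on I ?\<mu>"
    unfolding frame_mu_def by (intro smooth_intros s1 s2)
  have curv': "m t = deriv_on I \<nu>1 t \<bullet> ?\<mu> t" "n t = deriv_on I \<nu>2 t \<bullet> ?\<mu> t"
    "\<alpha> t = deriv_on I \<gamma> t \<bullet> ?\<mu> t" if "t \<in> I" for t
    using curv[OF that] by (simp_all add: framed_curvature_def)
  have sm: "smooth_on I m"
    by (subst smooth_on_cong[OF curv'(1)]) (assumption | intro smooth_intros s1 s\<mu>)+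
  have sn: "smooth_on I n"
    by (subst smooth_on_cong[OF curv'(2)]) (assumption | intro smooth_intros s2 s\<mu>)+
  have s\<alpha>: "smooth_on I \<alpha>"
    by (subst smooth_on_cong[OF curv'(3)]) (assumption | intro smooth_intros s0 s\<mu>)+
  have smbar: "smooth_on I mbar"
    by (subst smooth_on_cong[OF mbar]) (intro smooth_intros sm sn assms(4) | assumption)+
  have sr: "smooth_on I r"
    unfolding r_def by (intro smooth_intros s\<alpha> smbar mbar0)
  have sv: "smooth_on I v"
    by (subst smooth_on_cong[OF v]) (intro smooth_intros s1 s2 assms(4) | assumption)+
  have sw: "smooth_on I w"
    by (subst smooth_on_cong[OF w]) (intro smooth_intros s1 s2 assms(4) | assumption)+
  have slam: "smooth_on I lam"
    by (subst smooth_on_cong[OF lam]) (intro smooth_intros sr assms(4) | assumption)+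
  have seta: "smooth_on I eta"
    by (subst smooth_on_cong[OF eta]) (intro smooth_intros sr assms(4) | assumption)+

  have on: "\<nu>1 t \<bullet> \<nu>1 t = 1" "\<nu>2 t \<bullet> \<nu>2 t = 1" "\<nu>1 t \<bullet> \<nu>2 t = 0" if "t \<in> I" for t
    using F that by (auto simp: framed_curve_def Delta_def Let_def norm_eq_1)
  have \<mu>: "?\<mu> t \<bullet> ?\<mu> t = 1" "\<nu>1 t \<bullet> ?\<mu> t = 0" "\<nu>2 t \<bullet> ?\<mu> t = 0" if "t \<in> I" for t
    using norm_cross[of "\<nu>1 t" "\<nu>2 t"] on[OF that]
    by (auto simp: frame_mu_def power2_norm_eq_inner dot_cross_self)
  have vw: "v t \<bullet> v t = 1" "w t \<bullet> w t = 1" "v t \<bullet> w t = 0" "v t \<bullet> ?\<mu> t = 0" "w t \<bullet> ?\<mu> t = 0"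
    if "t \<in> I" for t
    using on[OF that] \<mu>[OF that] sin_cos_squared_add3[of "\<theta> t"]
    by (simp_all add: v[OF that] w[OF that] inner_diff_left inner_diff_right inner_add_left
        inner_add_right inner_commute[of "\<nu>2 t" "\<nu>1 t"] add.commute)

  have d\<theta>: "(\<theta> has_real_derivative l t) (at t within I)" if "t \<in> I" for t
    using smooth_on_has_vector_derivative[OF assms(4) that] assms(5) that
    by (simp add: has_real_derivative_iff_has_vector_derivative)
  have dr: "(r has_real_derivative deriv_on I r t) (at t within I)" if "t \<in> I" for t
    using smooth_on_has_vector_derivative[OF sr that]
    by (simp add: has_real_derivative_iff_has_vector_derivative)
  note frenet = framed_curve_structure_equations[OF I _ F curv]
  have d1: "(\<nu>1 has_vector_derivative l t *\<^sub>R \<nu>2 t + m t *\<^sub>R ?\<mu> t) (at t within I)"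
    and d2: "(\<nu>2 has_vector_derivative - l t *\<^sub>R \<nu>1 t + n t *\<^sub>R ?\<mu> t) (at t within I)"
    and d\<gamma>: "(\<gamma> has_vector_derivative \<alpha> t *\<^sub>R ?\<mu> t) (at t within I)" if "t \<in> I" for t
    using smooth_on_has_vector_derivative[OF s1 that] smooth_on_has_vector_derivative[OF s2 that]
      smooth_on_has_vector_derivative[OF s0 that] frenet[OF that that] by simp_all

  \<comment> \<open>The terms with \<open>\<theta>'\<close> and those with \<open>l\<close> cancel because \<open>\<theta>' = l\<close>.\<close>
  have dv: "(v has_vector_derivative mbar t *\<^sub>R ?\<mu> t) (at t within I)" if t: "t \<in> I" for t
  proof (rule has_vector_derivative_transform[OF t v])
    show "((\<lambda>s. cos (\<theta> s) *\<^sub>R \<nu>1 s - sin (\<theta> s) *\<^sub>R \<nu>2 s) has_vector_derivative mbar t *\<^sub>R ?\<mu> t)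
        (at t within I)"
      by (auto intro!: derivative_eq_intros d\<theta> d1 d2 t simp: mbar[OF t] algebra_simps)
  qed
  have dw: "(w has_vector_derivative (m t * sin (\<theta> t) + n t * cos (\<theta> t)) *\<^sub>R ?\<mu> t) (at t within I)"
    if t: "t \<in> I" for t
  proof (rule has_vector_derivative_transform[OF t w])
    show "((\<lambda>s. sin (\<theta> s) *\<^sub>R \<nu>1 s + cos (\<theta> s) *\<^sub>R \<nu>2 s) has_vector_derivative
        (m t * sin (\<theta> t) + n t * cos (\<theta> t)) *\<^sub>R ?\<mu> t) (at t within I)"
      by (auto intro!: derivative_eq_intros d\<theta> d1 d2 t simp: algebra_simps)
  qed
  show deriv_v: "\<forall>t\<in>I. deriv_on I v t = mbar t *\<^sub>R ?\<mu> t"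
    using deriv_on_eqI[OF perfect] dv by blast
  have deriv_w: "\<forall>t\<in>I. deriv_on I w t = (m t * sin (\<theta> t) + n t * cos (\<theta> t)) *\<^sub>R ?\<mu> t"
    using deriv_on_eqI[OF perfect] dw by blast
  have span: "v t \<in> span {\<nu>1 t, \<nu>2 t}" "w t \<in> span {\<nu>1 t, \<nu>2 t}" if "t \<in> I" for t
    unfolding v[OF that] w[OF that]
    by (intro span_diff span_add span_mul span_base; simp)+
  show "bishop_frame I \<nu>1 \<nu>2 v w"
    using sv sw vw \<mu>(1) deriv_v deriv_w span
    by (auto simp: bishop_frame_def Let_def norm_eq_1)

  have dlam: "deriv_on I lam t = eta t * l t - deriv_on I r t * cos (\<theta> t)"
    and deta: "deriv_on I eta t = deriv_on I r t * sin (\<theta> t) - lam t * l t" if t: "t \<in> I" for t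
  proof -
    have "(lam has_vector_derivative eta t * l t - deriv_on I r t * cos (\<theta> t)) (at t within I)"
      by (rule has_vector_derivative_transform[OF t lam])
        (auto simp flip: has_real_derivative_iff_has_vector_derivative
          intro!: derivative_eq_intros d\<theta> dr t simp: eta[OF t] algebra_simps)
    then show "deriv_on I lam t = eta t * l t - deriv_on I r t * cos (\<theta> t)"
      using deriv_on_eqI[OF perfect t] by blast
    have "(eta has_vector_derivative deriv_on I r t * sin (\<theta> t) - lam t * l t) (at t within I)"
      by (rule has_vector_derivative_transform[OF t eta])
        (auto simp flip: has_real_derivative_iff_has_vector_derivative
          intro!: derivative_eq_intros d\<theta> dr t simp: lam[OF t] algebra_simps)
    then show "deriv_on I eta t = deriv_on I r t * sin (\<theta> t) - lam t * l t"
      using deriv_on_eqI[OF perfect t] by blast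
  qed
  show "evolute_data I \<gamma> \<nu>1 \<nu>2 lam eta th"
    unfolding evolute_data_def
  proof (intro conjI ballI)
    show "smooth_on I (\<lambda>t. (lam t, eta t))"
      by (intro smooth_intros slam seta)
    show "smooth_on I th"
      using smooth_on_cong[of I th \<theta>] assms(4,12) by blast
    fix t assume t: "t \<in> I"
    have "\<alpha> t + lam t * m t + eta t * n t = \<alpha> t - r t * mbar t"
      by (simp add: lam[OF t] eta[OF t] mbar[OF t] algebra_simps)
    also have "\<dots> = 0"
      using mbar0[OF t] by (simp add: r_def)
    finally show "case framed_curvature I \<gamma> \<nu>1 \<nu>2 t of (l, m, n, \<alpha>) \<Rightarrow>
        \<alpha> + lam t * m + eta t * n = 0 \<and>
        (deriv_on I lam t - eta t * l) * sin (th t) + (lam t * l + deriv_on I eta t) * cos (th t) = 0"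
      using t assms(12) by (simp add: curv[OF t] dlam deta)
  qed

  have evolute: "evolute_curve \<gamma> \<nu>1 \<nu>2 lam eta t = \<gamma> t - r t *\<^sub>R v t" if "t \<in> I" for t
    by (simp add: evolute_curve_def lam eta v that algebra_simps)
  have circular: "circular_evolute I \<gamma> \<nu>1 \<nu>2 v t = \<gamma> t - r t *\<^sub>R v t" if "t \<in> I" for t
    using frenet(1)[OF that that] deriv_v \<mu>(1)[OF that] that
    by (simp add: circular_evolute_def r_def)
  show same: "\<forall>t\<in>I. evolute_curve \<gamma> \<nu>1 \<nu>2 lam eta t = circular_evolute I \<gamma> \<nu>1 \<nu>2 v t"
    using evolute circular by simp
  show "\<forall>t\<in>I. framed_evolute \<gamma> \<nu>1 \<nu>2 lam eta th t =
                  (circular_evolute I \<gamma> \<nu>1 \<nu>2 v t, w t, ?\<mu> t)"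
    using same w assms(12) by (simp add: framed_evolute_def)

  \<comment> \<open>The factor \<open>r = \<alpha> / mbar\<close> is the one for which the \<open>\<mu>\<close>-component \<open>\<alpha> - r mbar\<close> vanishes.\<close>
  have dE: "deriv_on I (\<lambda>s. \<gamma> s - r s *\<^sub>R v s) t = - deriv_on I r t *\<^sub>R v t" if t: "t \<in> I" for t
  proof (rule deriv_on_eqI[OF perfect t])
    have "r t * mbar t = \<alpha> t"
      using mbar0[OF t] by (simp add: r_def)
    then show "((\<lambda>s. \<gamma> s - r s *\<^sub>R v s) has_vector_derivative - deriv_on I r t *\<^sub>R v t)
        (at t within I)"
      by (auto intro!: derivative_eq_intros d\<gamma> dr dv t)
  qed
  have "framed_curve I (\<lambda>t. (\<gamma> t - r t *\<^sub>R v t, w t, ?\<mu> t))"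
    unfolding framed_curve_def
  proof (intro conjI ballI)
    show "smooth_on I (\<lambda>t. (\<gamma> t - r t *\<^sub>R v t, w t, ?\<mu> t))"
      by (intro smooth_intros s0 sr sv sw s\<mu>)
  qed (simp add: Let_def Delta_def norm_eq_1 vw \<mu>(1) dE)
  moreover have "framed_evolute \<gamma> \<nu>1 \<nu>2 lam eta th t = (\<gamma> t - r t *\<^sub>R v t, w t, ?\<mu> t)"
    if "t \<in> I" for t
    using that evolute w assms(12) by (simp add: framed_evolute_def)
  ultimately show "framed_curve I (framed_evolute \<gamma> \<nu>1 \<nu>2 lam eta th)"
    by (subst framed_curve_cong)
qed

end
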